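(* Let $\mathcal{E}=\mathcal{E}_0\oplus\mathcal{E}_1$ and $\mathcal{E}'=\mathcal{E}_0'\oplus\mathcal{E}_1'$ be orthogonal decompositions of complex Hilbert spaces (not necessarily separable), and let $T,T'$ be contractions from $\mathcal{E}$ to $\mathcal{E}'$ with block matrices $$T=\begin{pmatrix} T_0 & T_1 \\ T_2 & T_3 \end{pmatrix},\qquad T'=\begin{pmatrix} T_0' & T_1' \\ T_2' & T_3' \end{pmatrix}$$ with respect to these decompositions, satisfying $$T_0^*T_1+T_2^*T_3=T_0'^*T_1'+T_2'^*T_3'=0,\quad T_0^*T_1'+T_2^*T_3'=0,\quad T_1^*T_0'+T_3^*T_2'=0.$$ Let $C_0=\begin{pmatrix} T_0 \\ T_2 \end{pmatrix}$, $C_0'=\begin{pmatrix} T_0' \\ T_2' \end{pmatrix}:\mathcal{E}_0\to\mathcal{E}_0'\oplus\mathcal{E}_1'$ and $C_1=\begin{pmatrix} T_1 \\ T_3 \end{pmatrix}$, $C_1'=\begin{pmatrix} T_1' \\ T_3' \end{pmatrix}:\mathcal{E}_1\to\mathcal{E}_0'\oplus\mathcal{E}_1'$ be the column operators. If $C_0$ and $C_0'$ are Shmul'yan equivalent and $C_1$ and $C_1'$ are Shmul'yan equivalent, then $T$ and $T'$ are Shmul'yan equivalent.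
   Context: A contraction is a bounded linear operator of norm at most $1$. For a contraction $A$ between Hilbert spaces, $D_A=(I-A^*A)^{1/2}$ and $\mathcal{D}_A=\overline{\mathcal{R}(D_A)}$. For contractions $A,B\in\mathcal{B}(\mathcal{H}_1,\mathcal{H}_2)$, $A$ Shmul'yan dominates $B$ if $B=A+D_{A^*}XD_A$ for some bounded $X\in\mathcal{B}(\mathcal{D}_A,\mathcal{D}_{A^*})$; $A$ and $B$ are Shmul'yan equivalent if each Shmul'yan dominates the other. *)

theory Defs
  imports "HOL-Analysis.Analysis"
begin

text \<open>
  The inner product is linear in the first argument. The norm, the topology and the underlying
  real structure are those of class \<^class>\<open>real_inner\<close>, tied to the complex structure by
  \<open>scaleR_scaleC\<close> and \<open>inner_eq_Re_cinner\<close>; hence the norm of \<open>x\<close> is the square root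
  of \<open>cinner x x\<close>.
\<close>

class complex_inner = real_inner +
  fixes scaleC :: "complex \<Rightarrow> 'a \<Rightarrow> 'a" (infixr \<open>*\<^sub>C\<close> 75)
    and cinner :: "'a \<Rightarrow> 'a \<Rightarrow> complex"
  assumes scaleC_add_right: "c *\<^sub>C (x + y) = c *\<^sub>C x + c *\<^sub>C y"
    and scaleC_add_left: "(c + d) *\<^sub>C x = c *\<^sub>C x + d *\<^sub>C x"
    and scaleC_scaleC: "c *\<^sub>C (d *\<^sub>C x) = (c * d) *\<^sub>C x"
    and scaleC_one: "1 *\<^sub>C x = x"
    and scaleR_scaleC: "r *\<^sub>R x = complex_of_real r *\<^sub>C x"
    and cinner_commute: "cinner x y = cnj (cinner y x)"
    and cinner_add_left: "cinner (x + y) z = cinner x z + cinner y z"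
    and cinner_scaleC_left: "cinner (c *\<^sub>C x) y = c * cinner x y"
    and inner_eq_Re_cinner: "x \<bullet> y = Re (cinner x y)"

class chilbert_space = complex_inner + complete_space

text \<open>The product type is the orthogonal direct sum.\<close>

instantiation prod :: (complex_inner, complex_inner) complex_inner
begin

definition scaleC_prod :: "complex \<Rightarrow> 'a \<times> 'b \<Rightarrow> 'a \<times> 'b"
  where "scaleC_prod c x = (c *\<^sub>C fst x, c *\<^sub>C snd x)"

definition cinner_prod :: "'a \<times> 'b \<Rightarrow> 'a \<times> 'b \<Rightarrow> complex"
  where "cinner_prod x y = cinner (fst x) (fst y) + cinner (snd x) (snd y)"

instance
proof
  fix x y z :: "'a \<times> 'b" and c d :: complex and r :: real
  show "c *\<^sub>C (x + y) = c *\<^sub>C x + c *\<^sub>C y"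
    by (simp add: scaleC_prod_def scaleC_add_right)
  show "(c + d) *\<^sub>C x = c *\<^sub>C x + d *\<^sub>C x"
    by (simp add: scaleC_prod_def scaleC_add_left)
  show "c *\<^sub>C (d *\<^sub>C x) = (c * d) *\<^sub>C x"
    by (simp add: scaleC_prod_def scaleC_scaleC)
  show "1 *\<^sub>C x = x"
    by (simp add: scaleC_prod_def scaleC_one)
  show "r *\<^sub>R x = complex_of_real r *\<^sub>C x"
    by (simp add: scaleC_prod_def scaleR_prod_def scaleR_scaleC)
  show "cinner x y = cnj (cinner y x)"
    unfolding cinner_prod_def complex_cnj_add by (metis cinner_commute)
  show "cinner (x + y) z = cinner x z + cinner y z"
    by (simp add: cinner_prod_def cinner_add_left)
  show "cinner (c *\<^sub>C x) y = c * cinner x y"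
    by (simp add: cinner_prod_def scaleC_prod_def cinner_scaleC_left algebra_simps)
  show "x \<bullet> y = Re (cinner x y)"
    by (simp add: cinner_prod_def inner_prod_def inner_eq_Re_cinner)
qed

end

instance prod :: (chilbert_space, chilbert_space) chilbert_space ..

text \<open>
  \<open>bounded_clinear_between H K A\<close>: the restriction of \<open>A\<close> to the subspace \<open>H\<close> is a bounded
  complex-linear operator from \<open>H\<close> to \<open>K\<close>; the values of \<open>A\<close> outside \<open>H\<close> are irrelevant.
\<close>

definition bounded_clinear_between ::
    "'a::complex_inner set \<Rightarrow> 'b::complex_inner set \<Rightarrow> ('a \<Rightarrow> 'b) \<Rightarrow> bool"
  where "bounded_clinear_between H K A \<longleftrightarrow>
    A ` H \<subseteq> K \<and>
    (\<forall>x\<in>H. \<forall>y\<in>H. A (x + y) = A x + A y) \<and>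
    (\<forall>c. \<forall>x\<in>H. A (c *\<^sub>C x) = c *\<^sub>C A x) \<and>
    (\<exists>M. \<forall>x\<in>H. norm (A x) \<le> M * norm x)"

abbreviation bounded_clinear :: "('a::complex_inner \<Rightarrow> 'b::complex_inner) \<Rightarrow> bool"
  where "bounded_clinear \<equiv> bounded_clinear_between UNIV UNIV"

definition contraction :: "('a::complex_inner \<Rightarrow> 'b::complex_inner) \<Rightarrow> bool"
  where "contraction A \<longleftrightarrow> bounded_clinear A \<and> onorm A \<le> 1"

definition cadjoint :: "('a::complex_inner \<Rightarrow> 'b::complex_inner) \<Rightarrow> 'b \<Rightarrow> 'a"
  where "cadjoint A = (THE B. \<forall>x y. cinner (A x) y = cinner x (B y))"

definition positive_op :: "('a::complex_inner \<Rightarrow> 'a) \<Rightarrow> bool"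
  where "positive_op S \<longleftrightarrow> bounded_clinear S \<and> (\<forall>x. cinner (S x) x \<in> \<real>\<^sub>\<ge>\<^sub>0)"

definition sqrt_op :: "('a::complex_inner \<Rightarrow> 'a) \<Rightarrow> 'a \<Rightarrow> 'a"
  where "sqrt_op P = (THE S. positive_op S \<and> S \<circ> S = P)"

definition defect :: "('a::complex_inner \<Rightarrow> 'b::complex_inner) \<Rightarrow> 'a \<Rightarrow> 'a"
  where "defect A = sqrt_op (\<lambda>x. x - cadjoint A (A x))"

definition defect_space :: "('a::complex_inner \<Rightarrow> 'b::complex_inner) \<Rightarrow> 'a set"
  where "defect_space A = closure (range (defect A))"

definition shmulyan_dominates ::
    "('a::complex_inner \<Rightarrow> 'b::complex_inner) \<Rightarrow> ('a \<Rightarrow> 'b) \<Rightarrow> bool"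
  where "shmulyan_dominates A B \<longleftrightarrow>
    contraction A \<and> contraction B \<and>
    (\<exists>X. bounded_clinear_between (defect_space A) (defect_space (cadjoint A)) X \<and>
         (\<forall>x. B x = A x + defect (cadjoint A) (X (defect A x))))"

definition shmulyan_equivalent ::
    "('a::complex_inner \<Rightarrow> 'b::complex_inner) \<Rightarrow> ('a \<Rightarrow> 'b) \<Rightarrow> bool"
  where "shmulyan_equivalent A B \<longleftrightarrow> shmulyan_dominates A B \<and> shmulyan_dominates B A"

text \<open>\<open>block_op T0 T1 T2 T3\<close> has first row \<open>T0 T1\<close> and second row \<open>T2 T3\<close>.\<close>

definition block_op ::
    "('a \<Rightarrow> 'c) \<Rightarrow> ('b \<Rightarrow> 'c) \<Rightarrow> ('a \<Rightarrow> 'd) \<Rightarrow> ('b \<Rightarrow> 'd) \<Rightarrow>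
     'a \<times> 'b \<Rightarrow> 'c::complex_inner \<times> 'd::complex_inner"
  where "block_op T0 T1 T2 T3 = (\<lambda>(x, y). (T0 x + T1 y, T2 x + T3 y))"

definition column_op :: "('a \<Rightarrow> 'c) \<Rightarrow> ('a \<Rightarrow> 'd) \<Rightarrow> 'a \<Rightarrow> 'c \<times> 'd"
  where "column_op A B = (\<lambda>x. (A x, B x))"

end

theory Submission
  imports Defs
begin

text \<open>
  \<open>T\<close> is the row of its columns \<open>C\<^sub>0\<close> and \<open>C\<^sub>1\<close>, whose ranges are orthogonal. Hence \<open>D\<^sub>T\<close> is the
  direct sum of the defect operators of the columns, while \<open>I - T T\<^sup>*\<close> is the product of the commuting
  operators \<open>I - C\<^sub>0 C\<^sub>0\<^sup>*\<close> and \<open>I - C\<^sub>1 C\<^sub>1\<^sup>*\<close>. So the defect operator of \<open>T\<^sup>*\<close> is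
  \<open>E = E\<^sub>0 E\<^sub>1 = E\<^sub>1 E\<^sub>0\<close>, where \<open>E\<^sub>i\<close> is the defect operator of \<open>C\<^sub>i\<^sup>*\<close>. The cross conditions
  place the range of \<open>C\<^sub>0' - C\<^sub>0\<close> in the kernel of \<open>C\<^sub>1\<^sup>*\<close>, on which \<open>E\<^sub>1\<^sup>2\<close> is the identity. If
  \<open>C\<^sub>0' - C\<^sub>0 = E\<^sub>0 X\<^sub>0 D\<close> with \<open>D\<close> the defect operator of \<open>C\<^sub>0\<close>, then
  \<open>E (E\<^sub>1 X\<^sub>0 D) = E\<^sub>1\<^sup>2 (C\<^sub>0' - C\<^sub>0) = C\<^sub>0' - C\<^sub>0\<close>, and symmetrically for \<open>C\<^sub>1\<close>. Therefore the row of
  \<open>E\<^sub>1 X\<^sub>0\<close> and \<open>E\<^sub>0 X\<^sub>1\<close> witnesses the domination of \<open>T'\<close> by \<open>T\<close>.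
\<close>

section \<open>The Riesz representation\<close>

lemma convex_dist_power2_le:
  fixes S :: "'a::real_inner set"
  assumes S: "convex S" "u \<in> S" "v \<in> S" and r: "dist x u \<le> r" "dist x v \<le> r"
  shows "(dist u v)\<^sup>2 \<le> 4 * (r\<^sup>2 - (infdist x S)\<^sup>2)"
proof -
  have "midpoint u v \<in> S"
    using midpoint_in_closed_segment[of u v] closed_segment_subset[OF S(2,3,1)] by blast
  then have "(infdist x S)\<^sup>2 \<le> (dist x (midpoint u v))\<^sup>2"
    by (intro power_mono infdist_le infdist_nonneg)
  moreover have "(dist x u)\<^sup>2 \<le> r\<^sup>2" "(dist x v)\<^sup>2 \<le> r\<^sup>2"
    using r by (simp_all add: power_mono)
  moreover have "(dist u v)\<^sup>2 + 4 * (dist x (midpoint u v))\<^sup>2 = 2 * (dist x u)\<^sup>2 + 2 * (dist x v)\<^sup>2"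
    unfolding dist_norm power2_norm_eq_inner midpoint_def
    by (simp add: inner_diff_left inner_diff_right inner_add_left inner_add_right inner_commute
        algebra_simps)
  ultimately show ?thesis by (simp add: algebra_simps)
qed

lemma convex_near_points_close:
  fixes S :: "'a::real_inner set"
  assumes "convex S" "0 < e"
  shows "\<exists>r>infdist x S. \<forall>u\<in>S \<inter> cball x r. \<forall>v\<in>S \<inter> cball x r. dist u v < e"
proof (intro exI conjI ballI)
  let ?r = "sqrt ((infdist x S)\<^sup>2 + e\<^sup>2 / 8)"
  show "infdist x S < ?r" using \<open>0 < e\<close> by (intro real_less_rsqrt) simp
  fix u v assume "u \<in> S \<inter> cball x ?r" "v \<in> S \<inter> cball x ?r"
  then have "(dist u v)\<^sup>2 \<le> 4 * (?r\<^sup>2 - (infdist x S)\<^sup>2)"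
    using \<open>convex S\<close> by (intro convex_dist_power2_le) auto
  also have "\<dots> < e\<^sup>2" using \<open>0 < e\<close> by simp
  finally show "dist u v < e" using \<open>0 < e\<close> by (simp add: power2_less_imp_less)
qed

lemma closed_convex_nearest_point:
  fixes S :: "'a::{real_inner,complete_space} set"
  assumes S: "convex S" "closed S" "S \<noteq> {}"
  shows "\<exists>q\<in>S. \<forall>m\<in>S. dist x q \<le> dist x m"
proof -
  define r where "r n = infdist x S + inverse (real (Suc n))" for n
  let ?N = "\<lambda>n. S \<inter> cball x (r n)"
  have nonempty: "?N n \<noteq> {}" for n
  proof -
    have "infdist x S < r n" by (simp add: r_def)
    then obtain m where "m \<in> S" "dist x m < r n"
      unfolding infdist_notempty[OF S(3)] using cINF_less_iff[OF S(3) bdd_below_image_dist] by blast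
    then show ?thesis by (auto intro: less_imp_le)
  qed
  have decreasing: "?N n \<subseteq> ?N m" if "m \<le> n" for m n
  proof -
    have "r n \<le> r m" using that by (simp add: r_def)
    then show ?thesis by auto
  qed
  have small: "\<exists>n. \<forall>u\<in>?N n. \<forall>v\<in>?N n. dist u v < e" if "0 < e" for e
  proof -
    obtain s where s: "infdist x S < s" "\<forall>u\<in>S \<inter> cball x s. \<forall>v\<in>S \<inter> cball x s. dist u v < e"
      using convex_near_points_close[OF S(1) \<open>0 < e\<close>] by blast
    then obtain n where "inverse (real (Suc n)) < s - infdist x S"
      using reals_Archimedean[of "s - infdist x S"] by auto
    then have "r n < s" by (simp add: r_def)
    with s(2) show ?thesis by (intro exI[of _ n]) auto
  qed
  obtain q where "\<Inter> (range ?N) = {q}"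
    using decreasing_closed_nest_sing[OF closed_Int[OF S(2) closed_cball] nonempty decreasing small]
    by blast
  then have q: "q \<in> ?N n" for n by blast
  have "r \<longlonglongrightarrow> infdist x S"
    unfolding r_def by (rule LIMSEQ_inverse_real_of_nat_add)
  then have "dist x q \<le> infdist x S" by (rule LIMSEQ_le_const) (use q in auto)
  then show ?thesis using q infdist_le by (meson IntD1 order_trans)
qed

text \<open>The representing vector is orthogonal to the kernel, hence proportional to the point of
  smallest norm in the hyperplane \<open>f = 1\<close>.\<close>

lemma riesz_representation:
  fixes f :: "'a::{real_inner,complete_space} \<Rightarrow> real"
  assumes "bounded_linear f"
  obtains z where "\<And>x. f x = x \<bullet> z"
proof (cases "\<forall>x. f x = 0")
  case True
  then show ?thesis using that[of 0] by simp
next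
  case False
  then obtain x0 where x0: "f x0 \<noteq> 0" by blast
  interpret f: bounded_linear f by (rule assms)
  let ?H = "{x. f x = 1}"
  have "convex ?H" by (simp add: convex_def f.add f.scaleR)
  moreover have "closed ?H" by (intro closed_Collect_eq continuous_intros f.continuous_on)
  ultimately have H: "convex ?H" "closed ?H" .
  have "x0 /\<^sub>R f x0 \<in> ?H" using x0 by (simp add: f.scaleR)
  then have "?H \<noteq> {}" by blast
  then obtain q where "q \<in> ?H" and nearest: "\<forall>m\<in>?H. dist 0 q \<le> dist 0 m"
    using closed_convex_nearest_point[OF H, of 0] by blast
  then have q: "f q = 1" by simp
  have orth: "q \<bullet> m = 0" if "f m = 0" for m
  proof -
    have "0 \<le> q \<bullet> (y - q)" if "f y = 1" for y
      using any_closest_point_dot[OF H \<open>q \<in> ?H\<close> _ nearest, of y] that by simp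
    from this[of "q + m"] this[of "q - m"] show ?thesis
      using that q by (simp add: f.add f.diff)
  qed
  have "q \<bullet> q \<noteq> 0" using q f.zero by auto
  have "f x = x \<bullet> (q /\<^sub>R (q \<bullet> q))" for x
  proof -
    have "q \<bullet> (x - f x *\<^sub>R q) = 0" by (rule orth) (simp add: f.diff f.scaleR q)
    then show ?thesis
      using \<open>q \<bullet> q \<noteq> 0\<close> by (simp add: inner_diff_right inner_commute field_simps)
  qed
  then show ?thesis by (rule that)
qed

section \<open>Square roots of \<open>I - B\<close>\<close>

interpretation blinfun_compose: bounded_bilinear "(o\<^sub>L)"
  by (rule bounded_bilinear_blinfun_compose)

text \<open>The square root of \<open>I - B\<close> is \<open>I - Y\<close> with \<open>Y\<close> a fixed point of
  \<open>Y = (B + Y\<^sup>2) / 2\<close>. The increments of the iteration are dominated in norm by those of the scalar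
  iteration with \<open>B = 1\<close>, which is increasing and bounded.\<close>

primrec sqrt_iter :: "('a::real_normed_vector \<Rightarrow>\<^sub>L 'a) \<Rightarrow> nat \<Rightarrow> 'a \<Rightarrow>\<^sub>L 'a" where
  "sqrt_iter B 0 = 0"
| "sqrt_iter B (Suc n) = (1/2) *\<^sub>R (B + (sqrt_iter B n o\<^sub>L sqrt_iter B n))"

primrec sqrt_iter_bound :: "nat \<Rightarrow> real" where
  "sqrt_iter_bound 0 = 0"
| "sqrt_iter_bound (Suc n) = (1 + (sqrt_iter_bound n)\<^sup>2) / 2"

definition sqrt_id_minus :: "('a::real_normed_vector \<Rightarrow>\<^sub>L 'a) \<Rightarrow> 'a \<Rightarrow>\<^sub>L 'a"
  where "sqrt_id_minus B = id_blinfun - lim (sqrt_iter B)"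

lemma sqrt_iter_bound_nonneg: "0 \<le> sqrt_iter_bound n"
  by (cases n) simp_all

lemma sqrt_iter_bound_le_1: "sqrt_iter_bound n \<le> 1"
proof (induction n)
  case (Suc n)
  then have "(sqrt_iter_bound n)\<^sup>2 \<le> 1" by (rule power_le_one[OF sqrt_iter_bound_nonneg])
  then show ?case by simp
qed simp

lemma convergent_sqrt_iter_bound: "convergent sqrt_iter_bound"
proof (rule Bseq_monoseq_convergent)
  show "Bseq sqrt_iter_bound"
    by (rule BseqI'[where K = 1]) (simp add: sqrt_iter_bound_nonneg sqrt_iter_bound_le_1)
  have "sqrt_iter_bound n \<le> sqrt_iter_bound (Suc n)" for n
    using zero_le_power2[of "1 - sqrt_iter_bound n"] by (simp add: power2_eq_square algebra_simps)
  then show "monoseq sqrt_iter_bound" by (simp add: monoseq_Suc)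
qed

lemma norm_sqrt_iter_le:
  assumes "norm B \<le> 1"
  shows "norm (sqrt_iter B n) \<le> sqrt_iter_bound n"
proof (induction n)
  case (Suc n)
  let ?Y = "sqrt_iter B n" and ?b = "sqrt_iter_bound n"
  have "norm (?Y o\<^sub>L ?Y) \<le> ?b * ?b"
    using norm_blinfun_compose mult_mono'[OF Suc Suc] by (rule order_trans) simp_all
  then have "norm (B + (?Y o\<^sub>L ?Y)) \<le> 1 + ?b * ?b"
    using assms by (intro norm_triangle_mono)
  then show ?case by (simp add: power2_eq_square)
qed simp

lemma norm_sqrt_iter_Suc_diff_le:
  assumes B: "norm B \<le> 1"
  shows "norm (sqrt_iter B (Suc n) - sqrt_iter B n) \<le> sqrt_iter_bound (Suc n) - sqrt_iter_bound n"
proof (induction n)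
  case 0
  show ?case using B by simp
next
  case (Suc n)
  define Y Z where "Y = sqrt_iter B n" and "Z = sqrt_iter B (Suc n)"
  define b c where "b = sqrt_iter_bound n" and "c = sqrt_iter_bound (Suc n)"
  have Y: "norm Y \<le> b" and Z: "norm Z \<le> c" and diff: "norm (Z - Y) \<le> c - b"
    using norm_sqrt_iter_le[OF B] Suc by (auto simp only: Y_def Z_def b_def c_def)
  have "norm (Z o\<^sub>L (Z - Y)) \<le> c * (c - b)"
    using norm_blinfun_compose mult_mono'[OF Z diff] by (rule order_trans) simp_all
  moreover have "norm ((Z - Y) o\<^sub>L Y) \<le> (c - b) * b"
    using norm_blinfun_compose mult_mono'[OF diff Y] by (rule order_trans) simp_all
  ultimately have "norm ((Z o\<^sub>L (Z - Y)) + ((Z - Y) o\<^sub>L Y)) \<le> c * (c - b) + (c - b) * b"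
    by (rule norm_triangle_mono)
  also have "(Z o\<^sub>L (Z - Y)) + ((Z - Y) o\<^sub>L Y) = (Z o\<^sub>L Z) - (Y o\<^sub>L Y)"
    by (simp add: blinfun_compose.diff_left blinfun_compose.diff_right)
  finally have "norm ((Z o\<^sub>L Z) - (Y o\<^sub>L Y)) \<le> c\<^sup>2 - b\<^sup>2"
    by (simp add: power2_eq_square algebra_simps)
  moreover have "sqrt_iter B (Suc (Suc n)) - Z = (1/2) *\<^sub>R ((Z o\<^sub>L Z) - (Y o\<^sub>L Y))"
    by (simp add: Y_def Z_def flip: scaleR_diff_right)
  moreover have "sqrt_iter_bound (Suc (Suc n)) - c = (c\<^sup>2 - b\<^sup>2) / 2"
    by (simp add: b_def c_def field_simps)
  ultimately show ?case
    unfolding Z_def[symmetric] c_def[symmetric] by (simp del: sqrt_iter.simps sqrt_iter_bound.simps)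
qed

lemma sqrt_iter_tendsto:
  fixes B :: "'a::banach \<Rightarrow>\<^sub>L 'a"
  assumes "norm B \<le> 1"
  shows "sqrt_iter B \<longlonglongrightarrow> id_blinfun - sqrt_id_minus B"
proof -
  obtain b where "sqrt_iter_bound \<longlonglongrightarrow> b"
    using convergent_sqrt_iter_bound by (auto simp: convergent_def)
  then have "summable (\<lambda>n. sqrt_iter_bound (Suc n) - sqrt_iter_bound n)"
    by (rule telescope_summable)
  then have "summable (\<lambda>n. sqrt_iter B (Suc n) - sqrt_iter B n)"
    by (rule summable_comparison_test') (rule norm_sqrt_iter_Suc_diff_le[OF assms])
  then have "convergent (\<lambda>m. \<Sum>n<m. sqrt_iter B (Suc n) - sqrt_iter B n)"
    by (simp only: summable_iff_convergent)
  then have "convergent (sqrt_iter B)"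
    unfolding sum_lessThan_telescope by simp
  then show ?thesis by (simp add: sqrt_id_minus_def convergent_LIMSEQ_iff)
qed

lemma sqrt_iter_apply_tendsto:
  fixes B :: "'a::banach \<Rightarrow>\<^sub>L 'a"
  assumes "norm B \<le> 1"
  shows "(\<lambda>n. sqrt_iter B n x) \<longlonglongrightarrow> x - sqrt_id_minus B x"
  using blinfun.tendsto[OF sqrt_iter_tendsto[OF assms] tendsto_const]
  by (simp add: blinfun.diff_left)

lemma norm_id_minus_sqrt_id_minus_le:
  fixes B :: "'a::banach \<Rightarrow>\<^sub>L 'a"
  assumes "norm B \<le> 1"
  shows "norm (id_blinfun - sqrt_id_minus B) \<le> 1"
proof (rule LIMSEQ_le_const2)
  show "(\<lambda>n. norm (sqrt_iter B n)) \<longlonglongrightarrow> norm (id_blinfun - sqrt_id_minus B)"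
    by (intro tendsto_norm sqrt_iter_tendsto assms)
  show "\<exists>N. \<forall>n\<ge>N. norm (sqrt_iter B n) \<le> 1"
    using norm_sqrt_iter_le[OF assms] sqrt_iter_bound_le_1 order_trans by blast
qed

lemma sqrt_id_minus_square:
  fixes B :: "'a::banach \<Rightarrow>\<^sub>L 'a"
  assumes "norm B \<le> 1"
  shows "sqrt_id_minus B (sqrt_id_minus B x) = x - B x"
proof -
  define Y where "Y = id_blinfun - sqrt_id_minus B"
  have lim: "sqrt_iter B \<longlonglongrightarrow> Y" unfolding Y_def by (rule sqrt_iter_tendsto[OF assms])
  then have "(\<lambda>n. sqrt_iter B (Suc n)) \<longlonglongrightarrow> (1/2) *\<^sub>R (B + (Y o\<^sub>L Y))"
    unfolding sqrt_iter.simps by (intro tendsto_intros blinfun_compose.tendsto)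
  then have "Y = (1/2) *\<^sub>R (B + (Y o\<^sub>L Y))" by (rule LIMSEQ_unique[OF LIMSEQ_Suc[OF lim]])
  then have "Y + Y = B + (Y o\<^sub>L Y)" by (metis scaleR_half_double scaleR_right_distrib)
  then have "Y x + Y x = B x + Y (Y x)" by (metis blinfun.add_left blinfun_apply_blinfun_compose)
  have "sqrt_id_minus B z = z - Y z" for z by (simp add: Y_def blinfun.diff_left)
  then have "sqrt_id_minus B (sqrt_id_minus B x) = x - (Y x + Y x) + Y (Y x)"
    by (simp add: blinfun.diff_right)
  also have "\<dots> = x - B x" by (simp add: \<open>Y x + Y x = B x + Y (Y x)\<close>)
  finally show ?thesis .
qed

lemma sqrt_iter_intertwine:
  fixes B :: "'a::real_normed_vector \<Rightarrow>\<^sub>L 'a" and C :: "'b::real_normed_vector \<Rightarrow>\<^sub>L 'b"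
  assumes "linear Z" "\<And>x. B (Z x) = Z (C x)"
  shows "sqrt_iter B n (Z x) = Z (sqrt_iter C n x)"
  using assms
  by (induction n arbitrary: x)
    (simp_all add: blinfun.add_left blinfun.scaleR_left linear_0 linear_add linear_scale)

lemma sqrt_id_minus_intertwine:
  fixes B :: "'a::banach \<Rightarrow>\<^sub>L 'a" and C :: "'b::banach \<Rightarrow>\<^sub>L 'b"
  assumes "norm B \<le> 1" "norm C \<le> 1" and Z: "bounded_linear Z" and comm: "\<And>x. B (Z x) = Z (C x)"
  shows "sqrt_id_minus B (Z x) = Z (sqrt_id_minus C x)"
proof -
  interpret Z: bounded_linear Z by (rule Z)
  have "(\<lambda>n. sqrt_iter B n (Z x)) \<longlonglongrightarrow> Z x - sqrt_id_minus B (Z x)"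
    by (rule sqrt_iter_apply_tendsto[OF assms(1)])
  moreover have "(\<lambda>n. Z (sqrt_iter C n x)) \<longlonglongrightarrow> Z (x - sqrt_id_minus C x)"
    by (rule Z.tendsto[OF sqrt_iter_apply_tendsto[OF assms(2)]])
  ultimately have "Z x - sqrt_id_minus B (Z x) = Z (x - sqrt_id_minus C x)"
    unfolding sqrt_iter_intertwine[OF Z.linear_axioms comm] by (rule LIMSEQ_unique)
  then show ?thesis by (simp add: Z.diff)
qed

lemma sqrt_iter_compose_eq_0:
  assumes "B o\<^sub>L C = 0"
  shows "sqrt_iter B m o\<^sub>L sqrt_iter C n = 0"
proof (rule blinfun_eqI)
  have sqrt_iter_0: "sqrt_iter 0 k = 0" for k :: nat by (induction k) simp_all
  have "B (C x) = 0" for x using assms by (metis blinfun_apply_blinfun_compose zero_blinfun.rep_eq)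
  then have "sqrt_iter B m (C x) = C (sqrt_iter 0 m x)" for x
    by (intro sqrt_iter_intertwine[where Z = C])
      (simp_all add: blinfun.bounded_linear_right bounded_linear.linear blinfun.zero_right)
  then have "sqrt_iter 0 n (sqrt_iter B m x) = sqrt_iter B m (sqrt_iter C n x)" for x
    by (intro sqrt_iter_intertwine[where Z = "sqrt_iter B m"])
      (simp_all add: blinfun.bounded_linear_right bounded_linear.linear blinfun.zero_right sqrt_iter_0)
  then show "(sqrt_iter B m o\<^sub>L sqrt_iter C n) x = blinfun_apply 0 x" for x
    by (simp add: sqrt_iter_0)
qed

lemma sqrt_iter_add_orthogonal:
  assumes "B o\<^sub>L C = 0" "C o\<^sub>L B = 0"
  shows "sqrt_iter (B + C) n = sqrt_iter B n + sqrt_iter C n"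
  by (induction n)
    (simp_all add: blinfun_compose.add_left blinfun_compose.add_right
      sqrt_iter_compose_eq_0[OF assms(1)] sqrt_iter_compose_eq_0[OF assms(2)] scaleR_right_distrib)

text \<open>The iterates of \<open>B\<close> and \<open>C\<close> are polynomials without constant term, so they add up to those
  of \<open>B + C\<close> and annihilate each other: \<open>(I - Y) (I - Z) = I - (Y + Z)\<close> for the limits \<open>Y\<close> and \<open>Z\<close>.\<close>

lemma sqrt_id_minus_add_orthogonal:
  fixes B C :: "'a::banach \<Rightarrow>\<^sub>L 'a"
  assumes norm: "norm B \<le> 1" "norm C \<le> 1" "norm (B + C) \<le> 1"
    and orth: "B o\<^sub>L C = 0" "C o\<^sub>L B = 0"
  shows "sqrt_id_minus (B + C) x = sqrt_id_minus B (sqrt_id_minus C x)"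
proof -
  define Y Z where "Y = id_blinfun - sqrt_id_minus B" and "Z = id_blinfun - sqrt_id_minus C"
  have lim: "sqrt_iter B \<longlonglongrightarrow> Y" "sqrt_iter C \<longlonglongrightarrow> Z"
    unfolding Y_def Z_def by (intro sqrt_iter_tendsto norm)+
  have "(\<lambda>n. sqrt_iter B n o\<^sub>L sqrt_iter C n) \<longlonglongrightarrow> (Y o\<^sub>L Z)" by (rule blinfun_compose.tendsto[OF lim])
  then have "Y o\<^sub>L Z = 0"
    unfolding sqrt_iter_compose_eq_0[OF orth(1)] by (simp add: LIMSEQ_const_iff)
  then have "Y (Z x) = 0" by (metis blinfun_apply_blinfun_compose zero_blinfun.rep_eq)
  have "(\<lambda>n. sqrt_iter B n + sqrt_iter C n) \<longlonglongrightarrow> Y + Z" by (rule tendsto_add[OF lim])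
  then have "id_blinfun - sqrt_id_minus (B + C) = Y + Z"
    unfolding sqrt_iter_add_orthogonal[OF orth, symmetric]
    by (rule LIMSEQ_unique[OF sqrt_iter_tendsto[OF norm(3)]])
  then have "sqrt_id_minus (B + C) = id_blinfun - (Y + Z)" by (simp add: algebra_simps)
  moreover have "sqrt_id_minus B = id_blinfun - Y" "sqrt_id_minus C = id_blinfun - Z"
    by (simp_all add: Y_def Z_def)
  ultimately show ?thesis
    using \<open>Y (Z x) = 0\<close> by (simp add: blinfun.diff_left blinfun.diff_right blinfun.add_left)
qed

section \<open>Bounded complex-linear operators and their adjoints\<close>

instance chilbert_space \<subseteq> banach ..

lemma bounded_clinear_iff:
  "bounded_clinear A \<longleftrightarrow> bounded_linear A \<and> (\<forall>c x. A (c *\<^sub>C x) = c *\<^sub>C A x)"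
proof
  assume A: "bounded_clinear A"
  then obtain M where M: "\<And>x. norm (A x) \<le> M * norm x"
    unfolding bounded_clinear_between_def by auto
  have "bounded_linear A"
    by (rule bounded_linear_intro[where K = M])
      (use A M in \<open>auto simp: bounded_clinear_between_def scaleR_scaleC mult.commute\<close>)
  then show "bounded_linear A \<and> (\<forall>c x. A (c *\<^sub>C x) = c *\<^sub>C A x)"
    using A by (simp add: bounded_clinear_between_def)
next
  assume A: "bounded_linear A \<and> (\<forall>c x. A (c *\<^sub>C x) = c *\<^sub>C A x)"
  then interpret bounded_linear A by blast
  show "bounded_clinear A"
    using A add bounded by (auto simp: bounded_clinear_between_def mult.commute)
qed

lemma bounded_clinear_imp_bounded_linear: "bounded_clinear A \<Longrightarrow> bounded_linear A"
  and bounded_clinear_imp_scaleC: "bounded_clinear A \<Longrightarrow> A (c *\<^sub>C x) = c *\<^sub>C A x"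
  by (simp_all add: bounded_clinear_iff)

lemma bounded_clinear_zero: "bounded_clinear A \<Longrightarrow> A 0 = 0"
  and bounded_clinear_add: "bounded_clinear A \<Longrightarrow> A (x + y) = A x + A y"
  and bounded_clinear_diff: "bounded_clinear A \<Longrightarrow> A (x - y) = A x - A y"
  by (simp_all add: bounded_clinear_imp_bounded_linear linear_simps)

lemma bounded_clinear_compose:
  "bounded_clinear A \<Longrightarrow> bounded_clinear B \<Longrightarrow> bounded_clinear (\<lambda>x. A (B x))"
  by (simp add: bounded_clinear_iff bounded_linear_compose)

lemma cinner_scaleC_right: "cinner x (c *\<^sub>C y) = cnj c * cinner x y"
  by (metis cinner_commute cinner_scaleC_left complex_cnj_mult)

lemma inner_scaleC_left: "(c *\<^sub>C x) \<bullet> y = x \<bullet> (cnj c *\<^sub>C y)"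
  by (simp add: inner_eq_Re_cinner cinner_scaleC_left cinner_scaleC_right)

lemma cinner_conv_inner: "cinner x y = Complex (x \<bullet> y) (- ((\<i> *\<^sub>C x) \<bullet> y))"
  by (simp add: inner_eq_Re_cinner cinner_scaleC_left complex_eq_iff)

lemma scaleC_minus_left: "(- c) *\<^sub>C x = - (c *\<^sub>C (x::'a::complex_inner))"
  using scaleR_scaleC[of "-1" "c *\<^sub>C x"] by (simp add: scaleC_scaleC)

lemma scaleC_ii_ii: "\<i> *\<^sub>C (\<i> *\<^sub>C x) = - (x::'a::complex_inner)"
  by (simp add: scaleC_scaleC scaleC_minus_left scaleC_one)

lemma inner_scaleC_ii_left: "(\<i> *\<^sub>C x) \<bullet> y = - (x \<bullet> (\<i> *\<^sub>C y))"
  by (simp add: inner_scaleC_left scaleC_minus_left)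

lemma norm_scaleC: "norm (c *\<^sub>C x) = cmod c * norm (x::'a::complex_inner)"
proof -
  have "(norm (c *\<^sub>C x))\<^sup>2 = x \<bullet> ((cnj c * c) *\<^sub>C x)"
    by (simp add: power2_norm_eq_inner inner_scaleC_left scaleC_scaleC)
  also have "cnj c * c = complex_of_real ((cmod c)\<^sup>2)"
    by (metis complex_norm_square mult.commute)
  finally have "(norm (c *\<^sub>C x))\<^sup>2 = (cmod c * norm x)\<^sup>2"
    by (simp flip: scaleR_scaleC add: power_mult_distrib power2_norm_eq_inner)
  then show ?thesis by (simp add: power2_eq_iff_nonneg)
qed

lemma bounded_linear_scaleC: "bounded_linear (\<lambda>x::'a::complex_inner. c *\<^sub>C x)"
proof (rule bounded_linear_intro)
  show "c *\<^sub>C (r *\<^sub>R x) = r *\<^sub>R (c *\<^sub>C x)" for r and x :: 'a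
    by (simp add: scaleR_scaleC scaleC_scaleC mult.commute)
  show "norm (c *\<^sub>C x) \<le> norm x * cmod c" for x :: 'a
    by (simp add: norm_scaleC)
qed (rule scaleC_add_right)

lemma cadjoint_eqI:
  assumes A: "\<And>c x. A (c *\<^sub>C x) = c *\<^sub>C A x" and B: "\<And>x y. A x \<bullet> y = x \<bullet> B y"
  shows "cadjoint A = B"
  unfolding cadjoint_def
proof (rule the_equality)
  show "\<forall>x y. cinner (A x) y = cinner x (B y)"
    by (simp add: cinner_conv_inner B flip: A)
  fix B' assume "\<forall>x y. cinner (A x) y = cinner x (B' y)"
  then have "A x \<bullet> y = x \<bullet> B' y" for x y by (simp add: inner_eq_Re_cinner)
  then have "x \<bullet> B' y = x \<bullet> B y" for x y by (simp add: B)
  then have "B' y = B y" for y using vector_eq_ldot by blast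
  then show "B' = B" by (rule ext)
qed

lemma inner_cadjoint_right:
  fixes A :: "'a::chilbert_space \<Rightarrow> 'b::complex_inner"
  assumes A: "bounded_clinear A"
  shows "x \<bullet> cadjoint A y = A x \<bullet> y"
proof -
  have "\<exists>z. \<forall>x. A x \<bullet> y = x \<bullet> z" for y
  proof -
    have "bounded_linear (\<lambda>x. A x \<bullet> y)"
      using bounded_clinear_imp_bounded_linear[OF A]
      by (rule bounded_linear_compose[OF bounded_linear_inner_left])
    from riesz_representation[OF this] show ?thesis by blast
  qed
  then obtain B where B: "\<And>x y. A x \<bullet> y = x \<bullet> B y" by metis
  then have "cadjoint A = B" by (intro cadjoint_eqI bounded_clinear_imp_scaleC A)
  then show ?thesis by (simp add: B)
qed

lemma inner_cadjoint_left:
  fixes A :: "'a::chilbert_space \<Rightarrow> 'b::complex_inner"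
  assumes "bounded_clinear A"
  shows "cadjoint A y \<bullet> x = y \<bullet> A x"
  using inner_cadjoint_right[OF assms, of x y] by (simp add: inner_commute)

lemma norm_cadjoint_le:
  fixes A :: "'a::chilbert_space \<Rightarrow> 'b::complex_inner"
  assumes A: "bounded_clinear A"
  shows "norm (cadjoint A y) \<le> onorm A * norm y"
proof (cases "cadjoint A y = 0")
  case False
  let ?w = "cadjoint A y"
  have "norm ?w * norm ?w = A ?w \<bullet> y"
    by (simp add: norm_eq_sqrt_inner flip: inner_cadjoint_right[OF A])
  also have "\<dots> \<le> norm (A ?w) * norm y" by (rule norm_cauchy_schwarz)
  also have "\<dots> \<le> (onorm A * norm ?w) * norm y"
    by (intro mult_right_mono onorm bounded_clinear_imp_bounded_linear A) simp
  finally have "norm ?w * norm ?w \<le> norm ?w * (onorm A * norm y)" by (simp add: algebra_simps)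
  then show ?thesis using False by (simp add: mult_le_cancel_left)
qed (simp add: onorm_pos_le bounded_clinear_imp_bounded_linear A)

lemma bounded_clinear_cadjoint:
  fixes A :: "'a::chilbert_space \<Rightarrow> 'b::complex_inner"
  assumes A: "bounded_clinear A"
  shows "bounded_clinear (cadjoint A)"
proof -
  have eqI: "u = v" if "\<And>z. z \<bullet> u = z \<bullet> v" for u v :: 'a
    using that vector_eq_ldot by blast
  note adj = inner_cadjoint_right[OF A]
  have "bounded_linear (cadjoint A)"
  proof (rule bounded_linear_intro)
    show "cadjoint A (x + y) = cadjoint A x + cadjoint A y" for x y
      by (rule eqI) (simp add: adj inner_add_right)
    show "cadjoint A (r *\<^sub>R x) = r *\<^sub>R cadjoint A x" for r x
      by (rule eqI) (simp add: adj)
    show "norm (cadjoint A x) \<le> norm x * onorm A" for x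
      using norm_cadjoint_le[OF A, of x] by (simp add: mult.commute)
  qed
  moreover have "cadjoint A (c *\<^sub>C x) = c *\<^sub>C cadjoint A x" for c x
  proof (rule eqI)
    fix z
    have "z \<bullet> (c *\<^sub>C cadjoint A x) = A (cnj c *\<^sub>C z) \<bullet> x"
      by (simp add: inner_scaleC_left flip: adj)
    also have "\<dots> = z \<bullet> cadjoint A (c *\<^sub>C x)"
      by (simp add: adj bounded_clinear_imp_scaleC[OF A] inner_scaleC_left)
    finally show "z \<bullet> cadjoint A (c *\<^sub>C x) = z \<bullet> (c *\<^sub>C cadjoint A x)" by simp
  qed
  ultimately show ?thesis by (simp add: bounded_clinear_iff)
qed

lemma cadjoint_cadjoint:
  fixes A :: "'a::chilbert_space \<Rightarrow> 'b::complex_inner"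
  assumes A: "bounded_clinear A"
  shows "cadjoint (cadjoint A) = A"
  by (rule cadjoint_eqI)
    (simp_all add: bounded_clinear_imp_scaleC bounded_clinear_cadjoint inner_cadjoint_left A)

lemma cadjoint_comp_eq_0_commute:
  fixes A :: "'a::chilbert_space \<Rightarrow> 'h::complex_inner" and B :: "'b::chilbert_space \<Rightarrow> 'h"
  assumes A: "bounded_clinear A" and B: "bounded_clinear B" and orth: "\<And>x. cadjoint A (B x) = 0"
  shows "cadjoint B (A x) = 0"
proof -
  let ?w = "cadjoint B (A x)"
  have "?w \<bullet> ?w = A x \<bullet> B ?w" by (rule inner_cadjoint_left[OF B])
  also have "\<dots> = x \<bullet> cadjoint A (B ?w)" by (rule inner_cadjoint_right[OF A, symmetric])
  finally show ?thesis by (simp add: orth)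
qed

lemma contraction_imp_bounded_clinear: "contraction A \<Longrightarrow> bounded_clinear A"
  by (simp add: contraction_def)

lemma contraction_imp_norm_le:
  assumes "contraction A"
  shows "norm (A x) \<le> norm x"
proof -
  have "norm (A x) \<le> onorm A * norm x"
    using assms by (simp add: contraction_def bounded_clinear_imp_bounded_linear onorm)
  also have "\<dots> \<le> 1 * norm x" using assms by (intro mult_right_mono) (simp_all add: contraction_def)
  finally show ?thesis by simp
qed

lemma contraction_cadjoint:
  fixes A :: "'a::chilbert_space \<Rightarrow> 'b::complex_inner"
  assumes A: "contraction A"
  shows "contraction (cadjoint A)"
proof -
  have "onorm (cadjoint A) \<le> onorm A"
    using A by (intro onorm_bound norm_cadjoint_le onorm_pos_le)
      (simp_all add: contraction_def bounded_clinear_imp_bounded_linear)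
  then show ?thesis using A by (simp add: contraction_def bounded_clinear_cadjoint)
qed

section \<open>Positive operators\<close>

definition selfadjoint :: "('a::real_inner \<Rightarrow> 'a) \<Rightarrow> bool"
  where "selfadjoint A \<longleftrightarrow> (\<forall>x y. A x \<bullet> y = x \<bullet> A y)"

lemma positive_op_iff:
  "positive_op S \<longleftrightarrow> bounded_clinear S \<and> selfadjoint S \<and> (\<forall>x. 0 \<le> S x \<bullet> x)"
proof (cases "bounded_clinear S")
  case True
  interpret S: bounded_linear S by (rule bounded_clinear_imp_bounded_linear[OF True])
  note S_ii = bounded_clinear_imp_scaleC[OF True, of \<i>]
  have "selfadjoint S \<longleftrightarrow> (\<forall>x. (\<i> *\<^sub>C S x) \<bullet> x = 0)"
  proof
    assume S: "selfadjoint S"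
    show "\<forall>x. (\<i> *\<^sub>C S x) \<bullet> x = 0"
    proof
      fix x
      have "(\<i> *\<^sub>C S x) \<bullet> x = (\<i> *\<^sub>C x) \<bullet> S x" using S by (simp add: selfadjoint_def flip: S_ii)
      also have "\<dots> = - (x \<bullet> (\<i> *\<^sub>C S x))" by (rule inner_scaleC_ii_left)
      finally show "(\<i> *\<^sub>C S x) \<bullet> x = 0" by (simp add: inner_commute)
    qed
  next
    assume skew: "\<forall>x. (\<i> *\<^sub>C S x) \<bullet> x = 0"
    have polarized: "(\<i> *\<^sub>C S x) \<bullet> y + (\<i> *\<^sub>C S y) \<bullet> x = 0" for x y
      using skew[rule_format, of "x + y"] skew
      by (simp add: S.add scaleC_add_right inner_add_left inner_add_right)
    have "S x \<bullet> y = x \<bullet> S y" for x y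
    proof -
      have "(\<i> *\<^sub>C S y) \<bullet> (\<i> *\<^sub>C x) = S y \<bullet> x" by (simp add: inner_scaleC_ii_left scaleC_ii_ii)
      then show ?thesis
        using polarized[of "\<i> *\<^sub>C x" y] by (simp add: S_ii scaleC_ii_ii inner_commute)
    qed
    then show "selfadjoint S" by (simp add: selfadjoint_def)
  qed
  then show ?thesis
    using True
    by (auto simp: positive_op_def cinner_conv_inner[of "S x" for x] complex_nonneg_Reals_iff)
qed (simp add: positive_op_def)

lemma positive_op_imp_bounded_linear: "positive_op S \<Longrightarrow> bounded_linear S"
  by (simp add: positive_op_iff bounded_clinear_imp_bounded_linear)

lemma positive_op_eq_0:
  assumes S: "positive_op S" and null: "S y \<bullet> y = 0"
  shows "S y = 0"
proof -
  interpret S: bounded_linear S using S by (simp add: positive_op_imp_bounded_linear)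
  obtain K where K: "K > 0" "\<And>x. norm (S x) \<le> norm x * K" using S.pos_bounded by blast
  let ?z = "S y"
  let ?a = "?z \<bullet> ?z"
  have "S ?z \<bullet> ?z \<le> norm (S ?z) * norm ?z" by (rule norm_cauchy_schwarz)
  also have "\<dots> \<le> (norm ?z * K) * norm ?z" by (intro mult_right_mono K) simp
  also have "\<dots> = K * ?a" by (simp add: norm_eq_sqrt_inner)
  finally have bound: "S ?z \<bullet> ?z \<le> K * ?a" .
  have "0 \<le> S (K *\<^sub>R y - ?z) \<bullet> (K *\<^sub>R y - ?z)" using S by (simp add: positive_op_iff)
  also have "\<dots> = S ?z \<bullet> ?z - 2 * (K * ?a)"
    using S null
    by (simp add: positive_op_iff selfadjoint_def S.diff S.scaleR inner_diff_left inner_diff_right)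
  finally have "K * ?a \<le> 0" using bound by linarith
  then have "?a \<le> 0" using K(1) by (simp add: mult_le_0_iff)
  then show ?thesis by (metis inner_gt_zero_iff not_less)
qed

text \<open>\<open>(S + R) (S - R) = S\<^sup>2 - R\<^sup>2 = 0\<close>, so both \<open>S\<close> and \<open>R\<close> vanish on the range of \<open>S - R\<close>.\<close>

lemma commuting_positive_sqrt_unique:
  assumes S: "positive_op S" and R: "positive_op R"
    and square: "\<And>x. S (S x) = R (R x)" and comm: "\<And>x. S (R x) = R (S x)"
  shows "S = R"
proof
  fix x
  interpret S: bounded_linear S using S by (simp add: positive_op_imp_bounded_linear)
  interpret R: bounded_linear R using R by (simp add: positive_op_imp_bounded_linear)
  let ?y = "S x - R x"
  have "S ?y + R ?y = 0" by (simp add: S.diff R.diff square comm)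
  then have "S ?y \<bullet> ?y + R ?y \<bullet> ?y = 0" by (metis inner_add_left inner_zero_left)
  moreover have "0 \<le> S ?y \<bullet> ?y" "0 \<le> R ?y \<bullet> ?y" using S R by (simp_all add: positive_op_iff)
  ultimately have "S ?y = 0" "R ?y = 0"
    using positive_op_eq_0[OF S, of ?y] positive_op_eq_0[OF R, of ?y] by linarith+
  moreover have "?y \<bullet> ?y = x \<bullet> S ?y - x \<bullet> R ?y"
    using S R by (simp add: positive_op_iff selfadjoint_def inner_diff_left)
  ultimately show "S x = R x" by simp
qed

lemma selfadjoint_sqrt_id_minus:
  fixes B :: "'a::{real_inner,banach} \<Rightarrow>\<^sub>L 'a"
  assumes norm: "norm B \<le> 1" and B: "selfadjoint (blinfun_apply B)"
  shows "selfadjoint (blinfun_apply (sqrt_id_minus B))"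
  unfolding selfadjoint_def
proof (intro allI)
  fix x y
  have iter: "sqrt_iter B n x \<bullet> y = x \<bullet> sqrt_iter B n y" for n x y
    using B
    by (induction n arbitrary: x y)
      (simp_all add: selfadjoint_def blinfun.add_left blinfun.scaleR_left inner_add_left inner_add_right)
  have "(\<lambda>n. sqrt_iter B n x \<bullet> y) \<longlonglongrightarrow> (x - sqrt_id_minus B x) \<bullet> y"
    by (intro tendsto_intros sqrt_iter_apply_tendsto norm)
  moreover have "(\<lambda>n. sqrt_iter B n x \<bullet> y) \<longlonglongrightarrow> x \<bullet> (y - sqrt_id_minus B y)"
    unfolding iter by (intro tendsto_intros sqrt_iter_apply_tendsto norm)
  ultimately have "(x - sqrt_id_minus B x) \<bullet> y = x \<bullet> (y - sqrt_id_minus B y)"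
    by (rule LIMSEQ_unique)
  then show "sqrt_id_minus B x \<bullet> y = x \<bullet> sqrt_id_minus B y"
    by (simp add: inner_diff_left inner_diff_right)
qed

lemma inner_sqrt_id_minus_nonneg:
  fixes B :: "'a::{real_inner,banach} \<Rightarrow>\<^sub>L 'a"
  assumes "norm B \<le> 1"
  shows "0 \<le> sqrt_id_minus B x \<bullet> x"
proof -
  let ?Y = "id_blinfun - sqrt_id_minus B"
  have "norm (?Y x) \<le> 1 * norm x"
    using norm_blinfun mult_right_mono[OF norm_id_minus_sqrt_id_minus_le[OF assms] norm_ge_zero]
    by (rule order_trans)
  then have "?Y x \<bullet> x \<le> norm x * norm x"
    using norm_cauchy_schwarz[of "?Y x" x] mult_right_mono[of "norm (?Y x)" "norm x" "norm x"]
    by simp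
  then show ?thesis by (simp add: blinfun.diff_left inner_diff_left norm_eq_sqrt_inner)
qed

lemma positive_op_sqrt_id_minus:
  fixes B :: "'a::chilbert_space \<Rightarrow>\<^sub>L 'a"
  assumes "norm B \<le> 1" "bounded_clinear (blinfun_apply B)" "selfadjoint (blinfun_apply B)"
  shows "positive_op (blinfun_apply (sqrt_id_minus B))"
proof -
  have "sqrt_id_minus B (c *\<^sub>C x) = c *\<^sub>C sqrt_id_minus B x" for c x
    using assms(1,1) bounded_linear_scaleC bounded_clinear_imp_scaleC[OF assms(2)]
    by (rule sqrt_id_minus_intertwine)
  then show ?thesis
    using selfadjoint_sqrt_id_minus[OF assms(1,3)] inner_sqrt_id_minus_nonneg[OF assms(1)]
    by (simp add: positive_op_iff bounded_clinear_iff blinfun.bounded_linear_right)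
qed

lemma sqrt_op_id_minus:
  fixes B :: "'a::chilbert_space \<Rightarrow>\<^sub>L 'a"
  assumes B: "norm B \<le> 1" "bounded_clinear (blinfun_apply B)" "selfadjoint (blinfun_apply B)"
  shows "sqrt_op (\<lambda>x. x - B x) = sqrt_id_minus B"
  unfolding sqrt_op_def
proof (rule the_equality)
  let ?S = "blinfun_apply (sqrt_id_minus B)"
  note S = positive_op_sqrt_id_minus[OF B] and square = sqrt_id_minus_square[OF B(1)]
  show "positive_op ?S \<and> ?S \<circ> ?S = (\<lambda>x. x - B x)" using S square by auto
  fix R assume R: "positive_op R \<and> R \<circ> R = (\<lambda>x. x - B x)"
  then have R_square: "R (R x) = x - B x" for x by (metis comp_apply)
  interpret R: bounded_linear R using R by (simp add: positive_op_imp_bounded_linear)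
  have "B (R x) = R (B x)" for x using R_square[of "R x"] by (simp add: R_square R.diff)
  with B(1,1) R.bounded_linear_axioms have "?S (R x) = R (?S x)" for x
    by (rule sqrt_id_minus_intertwine)
  then show "R = ?S" using S R R_square square by (intro commuting_positive_sqrt_unique) simp_all
qed

section \<open>Defect operators\<close>

definition gram :: "('a::complex_inner \<Rightarrow> 'b::complex_inner) \<Rightarrow> 'a \<Rightarrow>\<^sub>L 'a"
  where "gram A = Blinfun (\<lambda>x. cadjoint A (A x))"

lemma blinfun_apply_gram:
  fixes A :: "'a::chilbert_space \<Rightarrow> 'b::complex_inner"
  assumes "bounded_clinear A"
  shows "blinfun_apply (gram A) = (\<lambda>x. cadjoint A (A x))"
  unfolding gram_def
  by (intro bounded_linear_Blinfun_apply bounded_clinear_imp_bounded_linear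
      bounded_clinear_compose[OF bounded_clinear_cadjoint] assms)

lemma bounded_clinear_gram:
  fixes A :: "'a::chilbert_space \<Rightarrow> 'b::complex_inner"
  assumes "bounded_clinear A"
  shows "bounded_clinear (blinfun_apply (gram A))"
  unfolding blinfun_apply_gram[OF assms]
  by (intro bounded_clinear_compose[OF bounded_clinear_cadjoint] assms)

lemma selfadjoint_gram:
  fixes A :: "'a::chilbert_space \<Rightarrow> 'b::complex_inner"
  assumes "bounded_clinear A"
  shows "selfadjoint (blinfun_apply (gram A))"
  by (simp add: selfadjoint_def blinfun_apply_gram inner_cadjoint_left inner_cadjoint_right assms)

lemma norm_gram_le_1:
  fixes A :: "'a::chilbert_space \<Rightarrow> 'b::complex_inner"
  assumes A: "contraction A"
  shows "norm (gram A) \<le> 1"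
proof (rule norm_blinfun_bound)
  fix x
  have "norm (cadjoint A (A x)) \<le> norm x"
    using contraction_imp_norm_le[OF contraction_cadjoint[OF A]] contraction_imp_norm_le[OF A]
    by (rule order_trans)
  then show "norm (gram A x) \<le> 1 * norm x"
    by (simp add: blinfun_apply_gram contraction_imp_bounded_clinear A)
qed simp

lemma defect_eq_sqrt_id_minus:
  fixes A :: "'a::chilbert_space \<Rightarrow> 'b::complex_inner"
  assumes "contraction A"
  shows "defect A = sqrt_id_minus (gram A)"
proof -
  have A: "bounded_clinear A" using assms by (rule contraction_imp_bounded_clinear)
  have "defect A = sqrt_op (\<lambda>x. x - gram A x)" by (simp add: defect_def blinfun_apply_gram[OF A])
  also have "\<dots> = sqrt_id_minus (gram A)"
    by (intro sqrt_op_id_minus norm_gram_le_1 bounded_clinear_gram selfadjoint_gram A assms)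
  finally show ?thesis .
qed

lemma bounded_clinear_defect:
  fixes A :: "'a::chilbert_space \<Rightarrow> 'b::complex_inner"
  assumes "contraction A"
  shows "bounded_clinear (defect A)"
proof -
  have "positive_op (defect A)"
    unfolding defect_eq_sqrt_id_minus[OF assms]
    by (intro positive_op_sqrt_id_minus norm_gram_le_1 bounded_clinear_gram selfadjoint_gram
        contraction_imp_bounded_clinear assms)
  then show ?thesis by (simp add: positive_op_iff)
qed

lemma defect_defect:
  fixes A :: "'a::chilbert_space \<Rightarrow> 'b::complex_inner"
  assumes "contraction A"
  shows "defect A (defect A x) = x - cadjoint A (A x)"
  using assms
  by (simp add: defect_eq_sqrt_id_minus sqrt_id_minus_square norm_gram_le_1 blinfun_apply_gram
      contraction_imp_bounded_clinear)

lemma defect_cadjoint_square_kernel: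
  fixes A :: "'a::chilbert_space \<Rightarrow> 'b::chilbert_space"
  assumes A: "contraction A" and "cadjoint A y = 0"
  shows "defect (cadjoint A) (defect (cadjoint A) y) = y"
proof -
  note lin = contraction_imp_bounded_clinear[OF A]
  have "defect (cadjoint A) (defect (cadjoint A) y) = y - A (cadjoint A y)"
    by (simp add: defect_defect contraction_cadjoint A cadjoint_cadjoint lin)
  also have "\<dots> = y" by (simp add: assms(2) bounded_clinear_zero[OF lin])
  finally show ?thesis .
qed

lemma defect_intertwine:
  fixes A :: "'a::chilbert_space \<Rightarrow> 'b::complex_inner"
    and B :: "'c::chilbert_space \<Rightarrow> 'd::complex_inner"
  assumes A: "contraction A" and B: "contraction B" and Z: "bounded_linear Z"
    and comm: "\<And>x. cadjoint A (A (Z x)) = Z (cadjoint B (B x))"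
  shows "defect A (Z x) = Z (defect B x)"
  unfolding defect_eq_sqrt_id_minus[OF A] defect_eq_sqrt_id_minus[OF B]
  using norm_gram_le_1[OF A] norm_gram_le_1[OF B] Z
  by (rule sqrt_id_minus_intertwine)
    (simp add: blinfun_apply_gram contraction_imp_bounded_clinear A B comm)

lemma defect_comp_orthogonal:
  fixes A :: "'h::chilbert_space \<Rightarrow> 'a::chilbert_space" and B :: "'h \<Rightarrow> 'b::chilbert_space"
    and R :: "'h \<Rightarrow> 'c::complex_inner"
  assumes A: "contraction A" and B: "contraction B" and R: "contraction R"
    and gram: "\<And>x. cadjoint R (R x) = cadjoint A (A x) + cadjoint B (B x)"
    and orth: "\<And>y. A (cadjoint B y) = 0"
  shows "defect R x = defect A (defect B x)"
proof -
  note lin = contraction_imp_bounded_clinear[OF A] contraction_imp_bounded_clinear[OF B]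
    contraction_imp_bounded_clinear[OF R]
  note lin_adj = bounded_clinear_cadjoint[OF lin(1)] bounded_clinear_cadjoint[OF lin(2)]
  have sum: "gram R = gram A + gram B"
    by (rule blinfun_eqI) (simp add: blinfun.add_left blinfun_apply_gram lin gram)
  have orth': "B (cadjoint A y) = 0" for y
    using cadjoint_comp_eq_0_commute[OF lin_adj] orth by (simp add: cadjoint_cadjoint lin)
  have "gram A o\<^sub>L gram B = 0" "gram B o\<^sub>L gram A = 0"
    by (auto intro!: blinfun_eqI simp: blinfun_apply_gram lin orth orth' bounded_clinear_zero lin_adj)
  moreover have "norm (gram A + gram B) \<le> 1" using norm_gram_le_1[OF R] by (simp add: sum)
  ultimately show ?thesis
    by (simp add: defect_eq_sqrt_id_minus A B R sum sqrt_id_minus_add_orthogonal norm_gram_le_1)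
qed

lemma bounded_clinear_between_defect_space:
  assumes Z: "bounded_clinear Z" and range: "\<And>x. Z (defect A x) \<in> range (defect B)"
  shows "bounded_clinear_between (defect_space A) (defect_space B) Z"
proof -
  have "Z ` defect_space A \<subseteq> closure (Z ` range (defect A))"
    unfolding defect_space_def
    by (intro closure_bounded_linear_image_subset bounded_clinear_imp_bounded_linear Z)
  also have "\<dots> \<subseteq> defect_space B"
    unfolding defect_space_def using range by (intro closure_mono) blast
  finally show ?thesis using Z by (auto simp: bounded_clinear_between_def)
qed

lemma defect_space_add:
  fixes A :: "'a::chilbert_space \<Rightarrow> 'b::complex_inner"
  assumes A: "contraction A" and "x \<in> defect_space A" "y \<in> defect_space A"
  shows "x + y \<in> defect_space A"
proof -
  have "defect A u + defect A v = defect A (u + v)" for u v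
    by (simp add: bounded_clinear_add bounded_clinear_defect A)
  then have "range (defect A) + range (defect A) \<subseteq> range (defect A)"
    by (auto simp: set_plus_def)
  then show ?thesis
    using assms(2,3) closure_sum closure_mono unfolding defect_space_def by blast
qed

section \<open>Shmul'yan domination of rows\<close>

lemma bounded_clinear_between_compose:
  assumes A: "bounded_clinear_between H K A" and B: "bounded_clinear_between K L B"
  shows "bounded_clinear_between H L (\<lambda>x. B (A x))"
proof -
  obtain M where M: "\<And>x. x \<in> H \<Longrightarrow> norm (A x) \<le> M * norm x"
    using A unfolding bounded_clinear_between_def by blast
  obtain N where N: "\<And>x. x \<in> K \<Longrightarrow> norm (B x) \<le> N * norm x"
    using B unfolding bounded_clinear_between_def by blast
  have A_mem: "A x \<in> K" if "x \<in> H" for x using A that by (auto simp: bounded_clinear_between_def)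
  have "norm (B (A x)) \<le> (\<bar>N\<bar> * M) * norm x" if "x \<in> H" for x
  proof -
    have "norm (B (A x)) \<le> \<bar>N\<bar> * norm (A x)"
      using N[OF A_mem[OF that]] mult_right_mono[OF abs_ge_self norm_ge_zero] by (rule order_trans)
    also have "\<dots> \<le> \<bar>N\<bar> * (M * norm x)" by (intro mult_left_mono M that) simp
    finally show ?thesis by (simp add: mult.assoc)
  qed
  then show ?thesis using A B A_mem unfolding bounded_clinear_between_def by auto
qed

lemma bounded_clinear_between_add:
  assumes A: "bounded_clinear_between H K A" and B: "bounded_clinear_between H K B"
    and K: "\<And>x y. x \<in> K \<Longrightarrow> y \<in> K \<Longrightarrow> x + y \<in> K"
  shows "bounded_clinear_between H K (\<lambda>x. A x + B x)"
proof -
  obtain M where M: "\<And>x. x \<in> H \<Longrightarrow> norm (A x) \<le> M * norm x"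
    using A unfolding bounded_clinear_between_def by blast
  obtain N where N: "\<And>x. x \<in> H \<Longrightarrow> norm (B x) \<le> N * norm x"
    using B unfolding bounded_clinear_between_def by blast
  have "norm (A x + B x) \<le> (M + N) * norm x" if "x \<in> H" for x
    using norm_triangle_mono[OF M[OF that] N[OF that]] by (simp add: distrib_right)
  then show ?thesis
    using A B K unfolding bounded_clinear_between_def by (auto simp: image_subset_iff scaleC_add_right)
qed

definition row_op :: "('a \<Rightarrow> 'h) \<Rightarrow> ('b \<Rightarrow> 'h) \<Rightarrow> 'a \<times> 'b \<Rightarrow> 'h::complex_inner"
  where "row_op A B = (\<lambda>(x, y). A x + B y)"

lemma row_op_apply: "row_op A B p = A (fst p) + B (snd p)"
  by (simp add: row_op_def split_beta)

lemma column_op_apply: "column_op A B x = (A x, B x)"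
  by (simp add: column_op_def)

lemma block_op_eq_row_op:
  "block_op T0 T1 T2 T3 = row_op (column_op T0 T2) (column_op T1 T3)"
  by (simp add: fun_eq_iff block_op_def column_op_apply row_op_apply)

lemma cadjoint_row_op:
  fixes A :: "'a::chilbert_space \<Rightarrow> 'h::complex_inner" and B :: "'b::chilbert_space \<Rightarrow> 'h"
  assumes A: "bounded_clinear A" and B: "bounded_clinear B"
  shows "cadjoint (row_op A B) = column_op (cadjoint A) (cadjoint B)"
proof (rule cadjoint_eqI)
  show "row_op A B (c *\<^sub>C p) = c *\<^sub>C row_op A B p" for c p
    by (simp add: row_op_apply scaleC_prod_def scaleC_add_right bounded_clinear_imp_scaleC A B)
  show "row_op A B p \<bullet> z = p \<bullet> column_op (cadjoint A) (cadjoint B) z" for p z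
    by (simp add: row_op_apply column_op_apply inner_prod_def inner_add_left inner_cadjoint_right A B)
qed

lemma cadjoint_column_op:
  fixes A :: "'h::chilbert_space \<Rightarrow> 'a::complex_inner" and B :: "'h \<Rightarrow> 'b::complex_inner"
  assumes A: "bounded_clinear A" and B: "bounded_clinear B"
  shows "cadjoint (column_op A B) = row_op (cadjoint A) (cadjoint B)"
proof (rule cadjoint_eqI)
  show "column_op A B (c *\<^sub>C x) = c *\<^sub>C column_op A B x" for c x
    by (simp add: column_op_apply scaleC_prod_def bounded_clinear_imp_scaleC A B)
  show "column_op A B x \<bullet> p = x \<bullet> row_op (cadjoint A) (cadjoint B) p" for x p
    by (simp add: row_op_apply column_op_apply inner_prod_def inner_add_right inner_cadjoint_right A B)
qed

locale orthogonal_row =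
  fixes A :: "'a::chilbert_space \<Rightarrow> 'h::chilbert_space" and B :: "'b::chilbert_space \<Rightarrow> 'h"
  assumes contraction_left: "contraction A" and contraction_right: "contraction B"
    and contraction_row_op: "contraction (row_op A B)"
    and orthogonal: "\<And>y. cadjoint A (B y) = 0"
begin

lemmas contractions = contraction_left contraction_right contraction_row_op
lemmas cadjoint_contractions = contractions[THEN contraction_cadjoint]
lemmas bounded_clinear_ops = contractions[THEN contraction_imp_bounded_clinear]

lemma orthogonal_swap: "cadjoint B (A x) = 0"
  using bounded_clinear_ops(1,2) orthogonal by (rule cadjoint_comp_eq_0_commute)

lemma defect_row_op: "defect (row_op A B) p = (defect A (fst p), defect B (snd p))"
proof -
  have gram: "cadjoint (row_op A B) (row_op A B q)
      = (cadjoint A (A (fst q)), cadjoint B (B (snd q)))" for q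
    by (simp add: cadjoint_row_op column_op_apply row_op_apply bounded_clinear_ops
        bounded_clinear_add bounded_clinear_cadjoint orthogonal orthogonal_swap)
  have "fst (defect (row_op A B) p) = defect A (fst p)"
    by (rule defect_intertwine[OF contractions(1,3) bounded_linear_fst, symmetric]) (simp add: gram)
  moreover have "snd (defect (row_op A B) p) = defect B (snd p)"
    by (rule defect_intertwine[OF contractions(2,3) bounded_linear_snd, symmetric]) (simp add: gram)
  ultimately show ?thesis by (simp add: prod_eq_iff)
qed

lemma defect_cadjoint_row_op:
  shows "defect (cadjoint (row_op A B)) z = defect (cadjoint A) (defect (cadjoint B) z)"
    and "defect (cadjoint (row_op A B)) z = defect (cadjoint B) (defect (cadjoint A) z)"
proof -
  have gram: "row_op A B (cadjoint (row_op A B) z) = A (cadjoint A z) + B (cadjoint B z)" for z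
    by (simp add: cadjoint_row_op bounded_clinear_ops column_op_apply row_op_apply)
  show "defect (cadjoint (row_op A B)) z = defect (cadjoint A) (defect (cadjoint B) z)"
    by (rule defect_comp_orthogonal[OF cadjoint_contractions])
      (simp_all add: cadjoint_cadjoint bounded_clinear_ops gram orthogonal)
  show "defect (cadjoint (row_op A B)) z = defect (cadjoint B) (defect (cadjoint A) z)"
    by (rule defect_comp_orthogonal[OF cadjoint_contractions(2,1,3)])
      (simp_all add: cadjoint_cadjoint bounded_clinear_ops gram orthogonal_swap add.commute)
qed

lemma defect_cadjoint_row_op_cancel_right:
  assumes "cadjoint B (defect (cadjoint A) u) = 0"
  shows "defect (cadjoint (row_op A B)) (defect (cadjoint B) u) = defect (cadjoint A) u"
proof -
  have "defect (cadjoint (row_op A B)) (defect (cadjoint B) u)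
      = defect (cadjoint B) (defect (cadjoint B) (defect (cadjoint A) u))"
    by (metis defect_cadjoint_row_op)
  also have "\<dots> = defect (cadjoint A) u"
    using contraction_right assms by (rule defect_cadjoint_square_kernel)
  finally show ?thesis .
qed

lemma defect_cadjoint_row_op_cancel_left:
  assumes "cadjoint A (defect (cadjoint B) v) = 0"
  shows "defect (cadjoint (row_op A B)) (defect (cadjoint A) v) = defect (cadjoint B) v"
proof -
  have "defect (cadjoint (row_op A B)) (defect (cadjoint A) v)
      = defect (cadjoint A) (defect (cadjoint A) (defect (cadjoint B) v))"
    by (metis defect_cadjoint_row_op)
  also have "\<dots> = defect (cadjoint B) v"
    using contraction_left assms by (rule defect_cadjoint_square_kernel)
  finally show ?thesis .
qed

lemma bounded_clinear_between_defect_space_row_op: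
  assumes X: "bounded_clinear_between (defect_space A) (defect_space (cadjoint A)) X"
    and Y: "bounded_clinear_between (defect_space B) (defect_space (cadjoint B)) Y"
  shows "bounded_clinear_between (defect_space (row_op A B)) (defect_space (cadjoint (row_op A B)))
    (\<lambda>p. defect (cadjoint B) (X (fst p)) + defect (cadjoint A) (Y (snd p)))"
proof (rule bounded_clinear_between_add)
  let ?H = "defect_space (row_op A B)" and ?K = "defect_space (cadjoint (row_op A B))"
  have fst: "bounded_clinear_between ?H (defect_space A) fst"
    and snd: "bounded_clinear_between ?H (defect_space B) snd"
    by (auto intro!: bounded_clinear_between_defect_space
        simp: bounded_clinear_iff bounded_linear_fst bounded_linear_snd scaleC_prod_def defect_row_op)
  have right: "bounded_clinear_between (defect_space (cadjoint A)) ?K (defect (cadjoint B))"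
    using cadjoint_contractions(2)
    by (intro bounded_clinear_between_defect_space bounded_clinear_defect)
      (simp_all flip: defect_cadjoint_row_op(2))
  have left: "bounded_clinear_between (defect_space (cadjoint B)) ?K (defect (cadjoint A))"
    using cadjoint_contractions(1)
    by (intro bounded_clinear_between_defect_space bounded_clinear_defect)
      (simp_all flip: defect_cadjoint_row_op(1))
  show "bounded_clinear_between ?H ?K (\<lambda>p. defect (cadjoint B) (X (fst p)))"
    by (rule bounded_clinear_between_compose[OF bounded_clinear_between_compose[OF fst X] right])
  show "bounded_clinear_between ?H ?K (\<lambda>p. defect (cadjoint A) (Y (snd p)))"
    by (rule bounded_clinear_between_compose[OF bounded_clinear_between_compose[OF snd Y] left])
qed (rule defect_space_add[OF cadjoint_contractions(3)])

lemma shmulyan_dominates_row_op: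
  assumes domA: "shmulyan_dominates A A'" and domB: "shmulyan_dominates B B'"
    and R': "contraction (row_op A' B')"
    and cross: "\<And>y. cadjoint A (B' y) = 0" "\<And>x. cadjoint B (A' x) = 0"
  shows "shmulyan_dominates (row_op A B) (row_op A' B')"
proof -
  obtain X where X: "bounded_clinear_between (defect_space A) (defect_space (cadjoint A)) X"
    and A': "\<And>x. A' x = A x + defect (cadjoint A) (X (defect A x))"
    using domA unfolding shmulyan_dominates_def by blast
  obtain Y where Y: "bounded_clinear_between (defect_space B) (defect_space (cadjoint B)) Y"
    and B': "\<And>y. B' y = B y + defect (cadjoint B) (Y (defect B y))"
    using domB unfolding shmulyan_dominates_def by blast
  let ?D = "defect (cadjoint (row_op A B))"
  let ?W = "\<lambda>p. defect (cadjoint B) (X (fst p)) + defect (cadjoint A) (Y (snd p))"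
  note adj = bounded_clinear_ops(1,2)[THEN bounded_clinear_cadjoint]
  have left: "?D (defect (cadjoint B) (X (defect A x))) = A' x - A x" for x
  proof -
    have "cadjoint B (A' x - A x) = 0"
      by (simp add: bounded_clinear_diff adj cross orthogonal_swap)
    then show ?thesis by (simp add: A' defect_cadjoint_row_op_cancel_right)
  qed
  have right: "?D (defect (cadjoint A) (Y (defect B y))) = B' y - B y" for y
  proof -
    have "cadjoint A (B' y - B y) = 0"
      by (simp add: bounded_clinear_diff adj cross orthogonal)
    then show ?thesis by (simp add: B' defect_cadjoint_row_op_cancel_left)
  qed
  have "?D (u + v) = ?D u + ?D v" for u v
    by (intro bounded_clinear_add bounded_clinear_defect cadjoint_contractions)
  then have "row_op A' B' p = row_op A B p + ?D (?W (defect (row_op A B) p))" for p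
    by (simp add: defect_row_op left right row_op_apply)
  then show ?thesis
    using contraction_row_op R' bounded_clinear_between_defect_space_row_op[OF X Y]
    unfolding shmulyan_dominates_def by blast
qed

end

theorem proposition3p5:
  fixes T0 T0' :: "'e0::chilbert_space \<Rightarrow> 'f0::chilbert_space"
    and T1 T1' :: "'e1::chilbert_space \<Rightarrow> 'f0"
    and T2 T2' :: "'e0 \<Rightarrow> 'f1::chilbert_space"
    and T3 T3' :: "'e1 \<Rightarrow> 'f1"
    and T T' :: "'e0 \<times> 'e1 \<Rightarrow> 'f0 \<times> 'f1"
    and C0 C0' :: "'e0 \<Rightarrow> 'f0 \<times> 'f1"
    and C1 C1' :: "'e1 \<Rightarrow> 'f0 \<times> 'f1"
  assumes blocks: "bounded_clinear T0" "bounded_clinear T1" "bounded_clinear T2" "bounded_clinear T3"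
    and blocks': "bounded_clinear T0'" "bounded_clinear T1'" "bounded_clinear T2'" "bounded_clinear T3'"
    and T: "T = block_op T0 T1 T2 T3" "contraction T"
    and T': "T' = block_op T0' T1' T2' T3'" "contraction T'"
    and orth: "\<forall>x. cadjoint T0 (T1 x) + cadjoint T2 (T3 x) = 0"
    and orth': "\<forall>x. cadjoint T0' (T1' x) + cadjoint T2' (T3' x) = 0"
    and cross0: "\<forall>x. cadjoint T0 (T1' x) + cadjoint T2 (T3' x) = 0"
    and cross1: "\<forall>x. cadjoint T1 (T0' x) + cadjoint T3 (T2' x) = 0"
    and C0: "C0 = column_op T0 T2" and C0': "C0' = column_op T0' T2'"
    and C1: "C1 = column_op T1 T3" and C1': "C1' = column_op T1' T3'"
    and equiv0: "shmulyan_equivalent C0 C0'"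
    and equiv1: "shmulyan_equivalent C1 C1'"
  shows "shmulyan_equivalent T T'"
proof -
  have dom: "shmulyan_dominates C0 C0'" "shmulyan_dominates C0' C0"
    "shmulyan_dominates C1 C1'" "shmulyan_dominates C1' C1"
    using equiv0 equiv1 by (simp_all add: shmulyan_equivalent_def)
  then have lin: "bounded_clinear C0" "bounded_clinear C0'" "bounded_clinear C1" "bounded_clinear C1'"
    by (simp_all add: shmulyan_dominates_def contraction_def)
  have row: "T = row_op C0 C1" "T' = row_op C0' C1'"
    by (simp_all add: T T' C0 C0' C1 C1' block_op_eq_row_op)
  have orth: "cadjoint C0 (C1 x) = 0" "cadjoint C0' (C1' x) = 0" "cadjoint C0 (C1' x) = 0"
    "cadjoint C1 (C0' y) = 0" for x y
    using orth orth' cross0 cross1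
    by (simp_all add: C0 C0' C1 C1' cadjoint_column_op blocks blocks' row_op_apply column_op_apply)
  then have "cadjoint C1' (C0 y) = 0" "cadjoint C0' (C1 x) = 0" for x y
    using cadjoint_comp_eq_0_commute lin by blast+
  with dom orth T(2) T'(2) show ?thesis
    unfolding shmulyan_equivalent_def row
    by (intro conjI orthogonal_row.shmulyan_dominates_row_op orthogonal_row.intro)
      (simp_all add: shmulyan_dominates_def)
qed

end
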